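(* Let $\mathbb{F}$ be a finite field, $A_1,\dots,A_m\subseteq\mathbb{F}$ nonempty, $\mathcal{A}=A_1\times\cdots\times A_m$, $\vec d=(d_1,\dots,d_m)\in\mathbb{N}^m$ with $d_i\ge|A_i|-1$ for all $i$, and let $S\subseteq\mathbb{F}^{\le m}$ be $\mathcal{A}$-closed. Let $X\in\{\varnothing,\mathcal{A}\}$. Then, inside $\mathbb{F}^S$, $$\big(Z_X(\Sigma\mathrm{RM}[\mathbb{F},\mathcal{A},\vec d])|_S\big)^{\perp}=\mathrm{Span}\Big(\{z_{\vec s}\}_{\vec s\in S^*}\cup\bigcup_{i=1}^m\big(Z_{X_i}(\mathrm{RM}[\mathbb{F},i,(d_1,\dots,d_i)])|_{S_i}\big)^{\perp}\Big),$$ where each vector in $\big(Z_{X_i}(\mathrm{RM}[\mathbb{F},i,(d_1,\dots,d_i)])|_{S_i}\big)^\perp\subseteq\mathbb{F}^{S_i}$ is viewed in $\mathbb{F}^S$ by padding with zeros.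
   Context: $\mathbb{F}^{\le m}=\bigcup_{i=0}^m\mathbb{F}^i$ (with $\mathbb{F}^0=\{\bot\}$ the empty tuple). $\mathrm{RM}[\mathbb{F},i,(d_1,\dots,d_i)]\subseteq\mathbb{F}^{\mathbb{F}^i}$ is the code of evaluation tables over $\mathbb{F}^i$ of polynomials with $\deg_{X_j}\le d_j$. With $\mathcal{A}_{>i}=A_{i+1}\times\cdots\times A_m$, for $P:\mathbb{F}^m\to\mathbb{F}$ define $\Sigma_{\mathcal{A}}[P]:\mathbb{F}^{\le m}\to\mathbb{F}$ by $\Sigma_{\mathcal{A}}[P](\vec x)=\sum_{\vec y\in\mathcal{A}_{>|\vec x|}}P(\vec x,\vec y)$, and $\Sigma\mathrm{RM}[\mathbb{F},\mathcal{A},\vec d]=\{\Sigma_{\mathcal{A}}[P]:P\in\mathrm{RM}[\mathbb{F},m,\vec d]\}$. For a code $C\subseteq\mathbb{F}^D$ and $Y\subseteq D$, $Z_Y(C)=\{w\in C:w|_Y=0\}$ and $C|_I=\{w|_I:w\in C\}$; duals are with respect to the standard dot product. $S$ is $\mathcal{A}$-closed if (i) whenever $(s_1,\dots,s_t)\in S$ with $t\ge1$, also $(s_1,\dots,s_{t-1})\in S$, and (ii) whenever $(s_1,\dots,s_\ell)\in S$, then $(s_1,\dots,s_{\ell-1},a)\in S$ for every $a\in A_\ell$. Notation: $S_i=\{\vec s\in S:|\vec s|=i\}$; $S^*=\{\vec s\in S:\exists t\in\mathbb{F},\ (\vec s,t)\in S\}$; for $\vec s\in S^*$, $z_{\vec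 s}\in\mathbb{F}^S$ has $z_{\vec s}(\vec s)=1$, $z_{\vec s}((\vec s,a))=-1$ for every $a\in A_{|\vec s|+1}$, and $0$ elsewhere; $X_i=\varnothing$ if $X=\varnothing$ and $X_i=A_1\times\cdots\times A_i$ if $X=\mathcal{A}$.
   Formalization: The case X = 𝒜 with S = {⊥} is excluded: there every codeword vanishing on 𝒜 is 0 at ⊥, so the left side is all of F^S (dimension 1), while S* and all S_i with i ≥ 1 are empty and the right side is {0}. *)

theory Defs
  imports Complex_Main "HOL-Library.Poly_Mapping" "HOL-Library.Function_Algebras"
begin

text \<open>
  Tuples over the field are lists; the empty tuple is \<open>[]\<close>. The sets \<open>A\<^sub>1, \<dots>, A\<^sub>m\<close> and the degree
  bounds \<open>d\<^sub>1, \<dots>, d\<^sub>m\<close> are lists of length \<open>m\<close>, so \<open>A\<^sub>i\<close> is \<open>As ! (i - 1)\<close>, and the products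
  \<open>A\<^sub>1 \<times> \<dots> \<times> A\<^sub>i\<close> and \<open>A\<^bsub>i+1\<^esub> \<times> \<dots> \<times> A\<^sub>m\<close> are \<open>listset (take i As)\<close> and \<open>listset (drop i As)\<close>.
\<close>

definition tuples :: "nat \<Rightarrow> 'a list set" where
  "tuples i = {x. length x = i}"

definition tuples_upto :: "nat \<Rightarrow> 'a list set" where
  "tuples_upto m = (\<Union>i\<le>m. tuples i)"

text \<open>
  A vector of \<open>F\<^bsup>D\<^esup>\<close> is a function that vanishes outside \<open>D\<close>. Hence, for \<open>D \<subseteq> E\<close>, padding a
  vector of \<open>F\<^bsup>D\<^esup>\<close> with zeros to a vector of \<open>F\<^bsup>E\<^esup>\<close> leaves the representing function unchanged.
\<close>

definition words :: "'i set \<Rightarrow> ('i \<Rightarrow> 'a::zero) set" where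
  "words D = {w. \<forall>x. x \<notin> D \<longrightarrow> w x = 0}"

definition restr :: "'i set \<Rightarrow> ('i \<Rightarrow> 'a::zero) \<Rightarrow> 'i \<Rightarrow> 'a" where
  "restr D w = (\<lambda>x. if x \<in> D then w x else 0)"

definition restr_code :: "'i set \<Rightarrow> ('i \<Rightarrow> 'a::zero) set \<Rightarrow> ('i \<Rightarrow> 'a) set" where
  "restr_code D C = restr D ` C"

definition zero_code :: "'i set \<Rightarrow> ('i \<Rightarrow> 'a::zero) set \<Rightarrow> ('i \<Rightarrow> 'a) set" where
  "zero_code Y C = {w \<in> C. \<forall>y\<in>Y. w y = 0}"

definition dual :: "'i set \<Rightarrow> ('i \<Rightarrow> 'a::comm_semiring_1) set \<Rightarrow> ('i \<Rightarrow> 'a) set" where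
  "dual D C = {u \<in> words D. \<forall>w\<in>C. (\<Sum>x\<in>D. u x * w x) = 0}"

definition scale_word :: "'a::times \<Rightarrow> ('i \<Rightarrow> 'a) \<Rightarrow> 'i \<Rightarrow> 'a" where
  "scale_word c w = (\<lambda>x. c * w x)"

global_interpretation word: vector_space "scale_word :: 'a::field \<Rightarrow> ('i \<Rightarrow> 'a) \<Rightarrow> 'i \<Rightarrow> 'a"
  by unfold_locales (auto simp: scale_word_def algebra_simps)

text \<open>
  Multivariate polynomials map monomials (finitely supported exponent functions) to coefficients.
  The variable \<open>X\<^sub>j\<close> has index \<open>j - 1\<close>.
\<close>

type_synonym 'a mpoly = "(nat \<Rightarrow>\<^sub>0 nat) \<Rightarrow>\<^sub>0 'a"

definition mvars :: "'a::zero mpoly \<Rightarrow> nat set" where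
  "mvars p = (\<Union>e\<in>Poly_Mapping.keys p. Poly_Mapping.keys e)"

definition mdegree :: "nat \<Rightarrow> 'a::zero mpoly \<Rightarrow> nat" where
  "mdegree j p = Max (insert 0 ((\<lambda>e. Poly_Mapping.lookup e j) ` Poly_Mapping.keys p))"

definition meval :: "'a::comm_semiring_1 mpoly \<Rightarrow> 'a list \<Rightarrow> 'a" where
  "meval p x = (\<Sum>e\<in>Poly_Mapping.keys p.
     Poly_Mapping.lookup p e * (\<Prod>j<length x. (x ! j) ^ Poly_Mapping.lookup e j))"

definition RM :: "nat \<Rightarrow> nat list \<Rightarrow> ('a::comm_semiring_1 list \<Rightarrow> 'a) set" where
  "RM i ds = {restr (tuples i) (meval p) | p :: 'a mpoly.
     mvars p \<subseteq> {..<i} \<and> (\<forall>j<i. mdegree j p \<le> ds ! j)}"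

definition sum_table :: "'a set list \<Rightarrow> ('a list \<Rightarrow> 'a) \<Rightarrow> 'a::comm_semiring_1 list \<Rightarrow> 'a" where
  "sum_table As P =
     restr (tuples_upto (length As)) (\<lambda>x. \<Sum>y\<in>listset (drop (length x) As). P (x @ y))"

definition SigmaRM :: "'a set list \<Rightarrow> nat list \<Rightarrow> ('a::comm_semiring_1 list \<Rightarrow> 'a) set" where
  "SigmaRM As ds = sum_table As ` RM (length As) ds"

definition closed_under :: "'a set list \<Rightarrow> 'a list set \<Rightarrow> bool" where
  "closed_under As S \<longleftrightarrow>
     (\<forall>s t. s @ [t] \<in> S \<longrightarrow> s \<in> S) \<and>
     (\<forall>s t. s @ [t] \<in> S \<longrightarrow> (\<forall>a \<in> As ! length s. s @ [a] \<in> S))"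

definition level :: "'a list set \<Rightarrow> nat \<Rightarrow> 'a list set" where
  "level S i = {s \<in> S. length s = i}"

definition extendable :: "'a list set \<Rightarrow> 'a list set" where
  "extendable S = {s \<in> S. \<exists>t. s @ [t] \<in> S}"

definition zvec :: "'a set list \<Rightarrow> 'a list \<Rightarrow> 'a list \<Rightarrow> 'a::ring_1" where
  "zvec As s = (\<lambda>x. if x = s then 1
                    else if \<exists>a \<in> As ! length s. x = s @ [a] then - 1 else 0)"

definition prefix_box :: "'a set list \<Rightarrow> 'a list set \<Rightarrow> nat \<Rightarrow> 'a list set" where
  "prefix_box As X i = (if X = {} then {} else listset (take i As))"

text \<open>
  The dual code formula fails for \<open>S = {[]}\<close> and \<open>X = A\<^sub>1 \<times> \<dots> \<times> A\<^sub>m\<close>: a summation table that vanishes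
  on \<open>X\<close> also vanishes at \<open>[]\<close>, so the dual is the full line \<open>F\<^bsup>S\<^esup>\<close>, whereas no \<open>z\<close>-vector and no
  level \<open>i \<ge> 1\<close> contributes to the span. This is why that case has to be excluded.
\<close>

lemma trivial_tree_counterexample:
  fixes As :: "'a::{field,finite} set list"
  shows "dual {[]} (restr_code {[]} (zero_code (listset As) (SigmaRM As ds))) \<noteq>
    word.span (zvec As ` extendable {[]} \<union>
      (\<Union>i\<in>{1..length As}. dual (level {[]} i)
         (restr_code (level {[]} i) (zero_code (prefix_box As (listset As) i) (RM i (take i ds))))))"
  (is "?L \<noteq> word.span (?A \<union> ?B)")
proof
  assume eq: "?L = word.span (?A \<union> ?B)"
  have A: "?A = {}" by (simp add: extendable_def)
  have "?B \<subseteq> {0}" by (auto simp: level_def dual_def words_def fun_eq_iff)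
  then have "word.span (?A \<union> ?B) \<subseteq> word.span {0}" unfolding A by (intro word.span_mono) auto
  moreover have "word.span {0 :: 'a list \<Rightarrow> 'a} = {0}" by simp
  moreover have "(\<lambda>x. if x = [] then 1 else 0) \<in> ?L"
  proof -
    have box: "length y = length As" if "y \<in> listset As" for y
      using that by (induction As arbitrary: y) (auto simp: set_Cons_def)
    have "w [] = 0" if "w \<in> zero_code (listset As) (SigmaRM As ds)" for w
    proof -
      from that obtain P where P: "w = sum_table As P" and z: "\<forall>y\<in>listset As. w y = 0"
        by (auto simp: zero_code_def SigmaRM_def)
      have "P y = 0" if "y \<in> listset As" for y
        using z that box[OF that] by (force simp: P sum_table_def restr_def tuples_upto_def tuples_def)
      then show ?thesis by (simp add: P sum_table_def restr_def)
    qed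
    then show ?thesis by (auto simp: dual_def words_def restr_code_def restr_def)
  qed
  ultimately have "(\<lambda>x::'a list. if x = [] then 1 else 0 :: 'a) = 0" using eq by auto
  then show False by (auto simp: fun_eq_iff split: if_splits)
qed

end

theory Submission
  imports Defs "HOL-Computational_Algebra.Polynomial"
begin

text \<open>
  The inclusion from right to left holds because a summation table satisfies
  \<open>w(s) = \<Sum>\<^sub>a w(s,a)\<close> and its levels are Reed-Muller codewords. For the converse, by double duality it
  suffices that every word \<open>w\<close> on \<open>S\<close> which satisfies these sum relations on \<open>S\<close>, and whose levels
  extend to codewords \<open>R\<^sub>i\<close> on \<open>F\<^sup>i\<close>, extends to a summation table. Fix polynomials \<open>\<delta>\<^sub>i\<close> of degree
  \<open>|A\<^sub>i| - 1\<close> whose values on \<open>A\<^sub>i\<close> sum to 1. Then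
  \<open>Q\<^bsub>i+1\<^esub>(x,t) = R\<^bsub>i+1\<^esub>(x,t) + (Q\<^sub>i(x) - \<Sum>\<^sub>a R\<^bsub>i+1\<^esub>(x,a)) \<delta>\<^bsub>i+1\<^esub>(t)\<close> sums to \<open>Q\<^sub>i\<close> over the last
  coordinate, and the correction term vanishes whenever \<open>(x,t) \<in> S\<close>, because the sum relation
  holds at \<open>x\<close>. Hence \<open>Q\<^sub>m\<close> is the polynomial whose summation table extends \<open>w\<close>.
\<close>

section \<open>Duality in \<open>F\<^sup>D\<close>\<close>

lemma words_subspace: "word.subspace (words D :: ('i \<Rightarrow> 'a::field) set)"
  by (auto simp: word.subspace_def words_def scale_word_def)

lemma dual_subspace: "word.subspace (dual D (C :: ('i \<Rightarrow> 'a::field) set))"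
  by (auto simp: word.subspace_def dual_def words_def scale_word_def distrib_right sum.distrib
      mult.assoc sum_distrib_left[symmetric])

text \<open>A basis of \<open>C\<close> stays independent after adding \<open>w\<close>, so some
  linear functional is 1 at \<open>w\<close> and 0 on \<open>C\<close>. As \<open>D\<close> is
  finite, each functional acts on \<open>words D\<close> as the dot product with a fixed
  vector.\<close>

lemma exists_separating_word:
  fixes C :: "('i \<Rightarrow> 'a::field) set"
  assumes "finite D" and C: "word.subspace C" "C \<subseteq> words D" and "w \<in> words D" "w \<notin> C"
  shows "\<exists>u\<in>dual D C. (\<Sum>x\<in>D. u x * w x) \<noteq> 0"
proof -
  interpret vp: vector_space_pair "scale_word :: 'a \<Rightarrow> ('i \<Rightarrow> 'a) \<Rightarrow> _" "(*) :: 'a \<Rightarrow> 'a \<Rightarrow> 'a"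
    by unfold_locales (auto simp: algebra_simps)
  obtain B where B: "B \<subseteq> C" "word.independent B" "C = word.span B"
    using word.basis_exists[of C] C by (metis word.span_minimal subset_antisym)
  have ind: "word.independent (insert w B)"
    using B assms(5) by (simp add: word.independent_insertI)
  from vp.linear_independent_extend[OF ind, of "\<lambda>v. if v = w then 1 else 0"]
  obtain g where lin: "Vector_Spaces.linear scale_word (*) g"
    and g: "\<And>v. v \<in> insert w B \<Longrightarrow> g v = (if v = w then 1 else 0)" by blast
  \<comment> \<open>The coordinates of the representing vector are the values of \<open>g\<close> on
    the unit vectors.\<close>
  define u where "u = (\<lambda>x. if x \<in> D then g (\<lambda>y. if y = x then 1 else 0) else 0)"
  have repr: "g v = (\<Sum>x\<in>D. u x * v x)" if "v \<in> words D" for v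
  proof -
    have "v = (\<Sum>x\<in>D. scale_word (v x) (\<lambda>y. if y = x then 1 else 0))"
    proof
      fix y
      have "(\<Sum>x\<in>D. scale_word (v x) (\<lambda>y. if y = x then 1 else 0)) y
        = (\<Sum>x\<in>D. if y = x then v x else 0)"
        unfolding scale_word_def by (induction D rule: infinite_finite_induct) auto
      then show "v y = (\<Sum>x\<in>D. scale_word (v x) (\<lambda>y. if y = x then 1 else 0)) y"
        using that assms(1) by (simp add: words_def)
    qed
    then have "g v = g (\<Sum>x\<in>D. scale_word (v x) (\<lambda>y. if y = x then 1 else 0))"
      by (rule arg_cong)
    also have "\<dots> = (\<Sum>x\<in>D. v x * g (\<lambda>y. if y = x then 1 else 0))"
      by (simp only: vp.linear_sum[OF lin] vp.linear_scale[OF lin])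
    finally show ?thesis by (simp add: u_def mult.commute)
  qed
  have "g v = 0" if "v \<in> C" for v
  proof (rule vp.linear_eq_0_on_span[OF lin])
    show "v \<in> word.span B" using that B(3) by simp
    show "g b = 0" if "b \<in> B" for b using that g[of b] B(1) assms(5) by auto
  qed
  then have "(\<Sum>x\<in>D. u x * v x) = 0" if "v \<in> C" for v
    using repr[of v] that C(2) by auto
  then have "u \<in> dual D C" by (simp add: dual_def words_def u_def)
  moreover have "(\<Sum>x\<in>D. u x * w x) \<noteq> 0" using repr[OF assms(4)] g[of w] by simp
  ultimately show ?thesis by blast
qed

text \<open>The nontrivial half of double duality. It is applied to the span in the theorem and to
  the code of each single level.\<close>

lemma double_dual_subset:
  fixes C :: "('i \<Rightarrow> 'a::field) set"
  assumes "finite D" and "word.subspace C" and "C \<subseteq> words D" and "w \<in> words D"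
    and "\<And>u. u \<in> dual D C \<Longrightarrow> (\<Sum>x\<in>D. u x * w x) = 0"
  shows "w \<in> C"
  using exists_separating_word[OF assms(1-4)] assms(5) by blast

section \<open>Reed-Muller codes\<close>

definition monom_fun :: "nat \<Rightarrow> (nat \<Rightarrow>\<^sub>0 nat) \<Rightarrow> 'a::comm_semiring_1 list \<Rightarrow> 'a" where
  "monom_fun i e = restr (tuples i) (\<lambda>x. \<Prod>j<i. (x ! j) ^ Poly_Mapping.lookup e j)"

definition exponents :: "nat \<Rightarrow> nat list \<Rightarrow> (nat \<Rightarrow>\<^sub>0 nat) set" where
  "exponents i ds = {e. Poly_Mapping.keys e \<subseteq> {..<i} \<and> (\<forall>j<i. Poly_Mapping.lookup e j \<le> ds ! j)}"

lemma mdegree_le_iff: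
  "mdegree j p \<le> d \<longleftrightarrow> (\<forall>e\<in>Poly_Mapping.keys p. Poly_Mapping.lookup e j \<le> d)"
  by (simp add: mdegree_def)

lemma RM_alt:
  "(RM i ds :: ('a::comm_semiring_1 list \<Rightarrow> 'a) set)
    = {restr (tuples i) (meval p) | p. Poly_Mapping.keys p \<subseteq> exponents i ds}"
proof -
  have "mvars p \<subseteq> {..<i} \<and> (\<forall>j<i. mdegree j p \<le> ds ! j) \<longleftrightarrow> Poly_Mapping.keys p \<subseteq> exponents i ds"
    for p :: "'a mpoly"
    unfolding mvars_def mdegree_le_iff exponents_def UN_subset_iff by blast
  then show ?thesis by (simp add: RM_def)
qed

text \<open>The freedom in \<open>K\<close> allows \<open>p\<close>, \<open>q\<close> and
  \<open>p + q\<close> to be expanded over one index set, although their supports differ.\<close>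

lemma restr_meval_eq_sum:
  fixes p :: "'a::field mpoly"
  assumes "finite K" "Poly_Mapping.keys p \<subseteq> K"
  shows "restr (tuples i) (meval p)
    = (\<Sum>e\<in>K. scale_word (Poly_Mapping.lookup p e) (monom_fun i e))"
proof
  fix x
  have *: "(\<Sum>e\<in>K. scale_word (Poly_Mapping.lookup p e) (monom_fun i e)) x
    = (\<Sum>e\<in>K. Poly_Mapping.lookup p e * monom_fun i e x)"
    unfolding scale_word_def by (induction K rule: infinite_finite_induct) auto
  have "(\<Sum>e\<in>Poly_Mapping.keys p. Poly_Mapping.lookup p e * monom_fun i e x)
    = (\<Sum>e\<in>K. Poly_Mapping.lookup p e * monom_fun i e x)"
    by (rule sum.mono_neutral_left) (use assms in \<open>auto simp: in_keys_iff\<close>)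
  then show "restr (tuples i) (meval p) x
    = (\<Sum>e\<in>K. scale_word (Poly_Mapping.lookup p e) (monom_fun i e)) x"
    unfolding * by (auto simp: meval_def restr_def monom_fun_def tuples_def sum.neutral)
qed

text \<open>This description reduces linear statements about codewords to monomials, by induction
  over the span.\<close>

lemma RM_eq_span: "RM i ds = word.span (monom_fun i ` exponents i ds :: ('a::field list \<Rightarrow> 'a) set)"
proof
  show "RM i ds \<subseteq> word.span (monom_fun i ` exponents i ds :: ('a list \<Rightarrow> 'a) set)"
  proof
    fix f :: "'a list \<Rightarrow> 'a"
    assume "f \<in> RM i ds"
    then obtain p where p: "f = restr (tuples i) (meval p)" "Poly_Mapping.keys p \<subseteq> exponents i ds"
      by (auto simp: RM_alt)
    show "f \<in> word.span (monom_fun i ` exponents i ds)"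
      unfolding p(1) restr_meval_eq_sum[OF finite_keys order_refl]
      by (intro word.span_sum word.span_scale word.span_base) (use p(2) in auto)
  qed
  have "word.subspace (RM i ds :: ('a list \<Rightarrow> 'a) set)"
  proof (rule word.subspaceI)
    show "0 \<in> (RM i ds :: ('a list \<Rightarrow> 'a) set)"
      unfolding RM_alt by (auto intro!: exI[of _ 0] simp: meval_def restr_def)
  next
    fix f g :: "'a list \<Rightarrow> 'a"
    assume "f \<in> RM i ds" "g \<in> RM i ds"
    then obtain p q where p: "f = restr (tuples i) (meval p)" "Poly_Mapping.keys p \<subseteq> exponents i ds"
      and q: "g = restr (tuples i) (meval q)" "Poly_Mapping.keys q \<subseteq> exponents i ds"
      by (auto simp: RM_alt)
    let ?K = "Poly_Mapping.keys p \<union> Poly_Mapping.keys q"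
    have "f + g = restr (tuples i) (meval (p + q))"
      unfolding p q by (subst (1 2 3) restr_meval_eq_sum[of ?K])
        (use Poly_Mapping.keys_add[of p q] in
          \<open>auto simp: sum.distrib lookup_add word.scale_left_distrib\<close>)
    moreover have "Poly_Mapping.keys (p + q) \<subseteq> exponents i ds"
      using Poly_Mapping.keys_add[of p q] p(2) q(2) by blast
    ultimately show "f + g \<in> RM i ds" by (auto simp: RM_alt)
  next
    fix c and f :: "'a list \<Rightarrow> 'a"
    assume "f \<in> RM i ds"
    then obtain p where p: "f = restr (tuples i) (meval p)" "Poly_Mapping.keys p \<subseteq> exponents i ds"
      by (auto simp: RM_alt)
    let ?q = "Poly_Mapping.map ((*) c) p"
    have keys: "Poly_Mapping.keys ?q \<subseteq> Poly_Mapping.keys p"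
      by (auto simp: in_keys_iff map.rep_eq when_def)
    have "scale_word c f = restr (tuples i) (meval ?q)"
      unfolding p by (subst (1 2) restr_meval_eq_sum[of "Poly_Mapping.keys p"])
        (use keys in \<open>auto simp: word.scale_sum_right map.rep_eq when_def intro!: sum.cong\<close>)
    then show "scale_word c f \<in> RM i ds" using keys p(2) by (auto simp: RM_alt)
  qed
  moreover have "monom_fun i e \<in> (RM i ds :: ('a list \<Rightarrow> 'a) set)" if "e \<in> exponents i ds" for e
  proof -
    have "monom_fun i e = restr (tuples i) (meval (Poly_Mapping.single e (1::'a)))"
      by (subst restr_meval_eq_sum[of "{e}"]) auto
    then show ?thesis using that by (auto simp: RM_alt)
  qed
  ultimately show "word.span (monom_fun i ` exponents i ds) \<subseteq> (RM i ds :: ('a list \<Rightarrow> 'a) set)"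
    by (intro word.span_minimal) auto
qed

section \<open>Closure properties of Reed-Muller codes\<close>

lemma RM_subspace: "word.subspace (RM i ds :: ('a::field list \<Rightarrow> 'a) set)"
  unfolding RM_eq_span by (rule word.subspace_span)

lemma RM_outside: "f \<in> RM i ds \<Longrightarrow> length x \<noteq> i \<Longrightarrow> f x = 0"
  by (auto simp: RM_def restr_def tuples_def)

lemma RM_take: "i \<le> k \<Longrightarrow> RM i (take k ds) = RM i ds"
  by (simp add: RM_def)

lemma RM_const: "restr (tuples 0) (\<lambda>_. c) \<in> (RM 0 ds :: ('a::field list \<Rightarrow> 'a) set)"
proof -
  have "restr (tuples 0) (\<lambda>_. c) = scale_word c (monom_fun 0 0 :: 'a list \<Rightarrow> 'a)"
    by (auto simp: restr_def scale_word_def monom_fun_def)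
  moreover have "0 \<in> exponents 0 ds" by (simp add: exponents_def)
  ultimately show ?thesis unfolding RM_eq_span by (simp add: word.span_scale word.span_base)
qed

text \<open>Setting the last variable to \<open>a\<close> turns a monomial into the scalar
  \<open>a ^ Poly_Mapping.lookup e i\<close> times the monomial without that variable; the other
  exponents keep their bounds.\<close>

lemma RM_fix_last:
  fixes f :: "'a::field list \<Rightarrow> 'a"
  assumes "f \<in> RM (Suc i) ds"
  shows "restr (tuples i) (\<lambda>x. f (x @ [a])) \<in> RM i ds"
  using assms unfolding RM_eq_span[of "Suc i"]
proof (induction rule: word.span_induct_alt)
  case base
  show ?case using word.subspace_0[OF RM_subspace[of i ds]] by (simp add: restr_def zero_fun_def)
next
  case (step c g h)
  then obtain e where e: "g = monom_fun (Suc i) e" "e \<in> exponents (Suc i) ds" by auto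
  let ?e = "Poly_Mapping.update i 0 e"
  have "restr (tuples i) (\<lambda>x. g (x @ [a]))
    = scale_word (a ^ Poly_Mapping.lookup e i) (monom_fun i ?e)"
    by (auto simp: e monom_fun_def restr_def tuples_def scale_word_def fun_eq_iff nth_append
        lookup_update intro!: prod.cong)
  moreover have "?e \<in> exponents i ds"
    using e(2) by (auto simp: exponents_def lookup_update in_keys_iff subset_iff less_Suc_eq)
  ultimately have "restr (tuples i) (\<lambda>x. g (x @ [a])) \<in> RM i ds"
    unfolding RM_eq_span by (simp add: word.span_scale word.span_base)
  then have "scale_word c (restr (tuples i) (\<lambda>x. g (x @ [a]))) + restr (tuples i) (\<lambda>x. h (x @ [a]))
    \<in> RM i ds"
    using step.IH by (intro word.subspace_add word.subspace_scale RM_subspace)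
  also have "scale_word c (restr (tuples i) (\<lambda>x. g (x @ [a]))) + restr (tuples i) (\<lambda>x. h (x @ [a]))
    = restr (tuples i) (\<lambda>x. (scale_word c g + h) (x @ [a]))"
    by (auto simp: restr_def scale_word_def)
  finally show ?case .
qed

lemma RM_sum_last:
  fixes f :: "'a::field list \<Rightarrow> 'a"
  assumes "f \<in> RM (Suc i) ds"
  shows "restr (tuples i) (\<lambda>x. \<Sum>a\<in>A. f (x @ [a])) \<in> RM i ds"
proof -
  have "restr (tuples i) (\<lambda>x. \<Sum>a\<in>A. f (x @ [a])) = (\<Sum>a\<in>A. restr (tuples i) (\<lambda>x. f (x @ [a])))"
  proof (induction A rule: infinite_finite_induct)
    case (insert a A)
    show ?case unfolding sum.insert[OF insert.hyps] insert.IH[symmetric] by (auto simp: restr_def)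
  qed (auto simp: restr_def)
  then show ?thesis
    by (simp add: word.subspace_sum[OF RM_subspace] RM_fix_last[OF assms])
qed

lemma RM_mult_power_last:
  fixes f :: "'a::field list \<Rightarrow> 'a"
  assumes "f \<in> RM i ds" "k \<le> ds ! i"
  shows "restr (tuples (Suc i)) (\<lambda>x. f (butlast x) * last x ^ k) \<in> RM (Suc i) ds"
  using assms(1) unfolding RM_eq_span[of i]
proof (induction rule: word.span_induct_alt)
  case base
  show ?case
    using word.subspace_0[OF RM_subspace[of "Suc i" ds]] by (simp add: restr_def zero_fun_def)
next
  case (step c g h)
  then obtain e where e: "g = monom_fun i e" "e \<in> exponents i ds" by auto
  \<comment> \<open>The new variable has index \<open>i\<close>, which does not occur in
    \<open>e\<close>, so multiplying by its \<open>k\<close>-th power just sets this exponent to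
    \<open>k\<close>.\<close>
  let ?e = "Poly_Mapping.update i k e"
  have "restr (tuples (Suc i)) (\<lambda>x. g (butlast x) * last x ^ k) = monom_fun (Suc i) ?e"
  proof
    fix x :: "'a list"
    have "last x = x ! i" if "length x = Suc i"
      using that by (cases x rule: rev_cases) auto
    then show "restr (tuples (Suc i)) (\<lambda>x. g (butlast x) * last x ^ k) x = monom_fun (Suc i) ?e x"
      by (simp add: e monom_fun_def restr_def tuples_def nth_butlast lookup_update)
  qed
  moreover have "?e \<in> exponents (Suc i) ds"
    using e(2) assms(2)
    by (auto simp: exponents_def lookup_update in_keys_iff subset_iff less_Suc_eq split: if_splits)
  ultimately have "restr (tuples (Suc i)) (\<lambda>x. g (butlast x) * last x ^ k) \<in> RM (Suc i) ds"
    unfolding RM_eq_span by (auto intro!: word.span_base)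
  then have "scale_word c (restr (tuples (Suc i)) (\<lambda>x. g (butlast x) * last x ^ k))
      + restr (tuples (Suc i)) (\<lambda>x. h (butlast x) * last x ^ k) \<in> RM (Suc i) ds"
    using step.IH by (intro word.subspace_add word.subspace_scale RM_subspace)
  also have "scale_word c (restr (tuples (Suc i)) (\<lambda>x. g (butlast x) * last x ^ k))
      + restr (tuples (Suc i)) (\<lambda>x. h (butlast x) * last x ^ k)
    = restr (tuples (Suc i)) (\<lambda>x. (scale_word c g + h) (butlast x) * last x ^ k)"
    by (auto simp: restr_def scale_word_def algebra_simps)
  finally show ?case .
qed

lemma RM_mult_poly_last:
  fixes f :: "'a::field list \<Rightarrow> 'a"
  assumes "f \<in> RM i ds" "degree q \<le> ds ! i"
  shows "restr (tuples (Suc i)) (\<lambda>x. f (butlast x) * poly q (last x)) \<in> RM (Suc i) ds"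
proof -
  have *: "restr (tuples (Suc i)) (\<lambda>x. f (butlast x) * (\<Sum>k\<in>K. coeff q k * last x ^ k))
    = (\<Sum>k\<in>K. scale_word (coeff q k) (restr (tuples (Suc i)) (\<lambda>x. f (butlast x) * last x ^ k)))"
    for K
  proof (induction K rule: infinite_finite_induct)
    case (insert k K)
    show ?case unfolding sum.insert[OF insert.hyps] insert.IH[symmetric]
      by (auto simp: restr_def scale_word_def algebra_simps)
  qed (auto simp: restr_def)
  show ?thesis
    unfolding poly_altdef *
    by (intro word.subspace_sum[OF RM_subspace] word.subspace_scale[OF RM_subspace]
        RM_mult_power_last assms(1)) (use assms(2) in auto)
qed

text \<open>Take the Lagrange basis polynomial of one point \<open>b\<close> of \<open>A\<close>: it
  is 1 at \<open>b\<close> and 0 on the rest. Unlike the constant \<open>1 / card A\<close>, it also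
  works when the characteristic divides \<open>card A\<close>. Its degree is the source of the bound
  on \<open>ds\<close>.\<close>

lemma exists_poly_sum_eq_1:
  fixes A :: "'a::field set"
  assumes "finite A" "A \<noteq> {}"
  shows "\<exists>q. degree q \<le> card A - 1 \<and> (\<Sum>a\<in>A. poly q a) = 1"
proof -
  obtain b where b: "b \<in> A" using assms(2) by blast
  define r where "r = (\<Prod>c\<in>A-{b}. [:-c, 1:])"
  define q where "q = smult (inverse (poly r b)) r"
  have "poly r b \<noteq> 0" using assms(1) by (auto simp: r_def poly_prod)
  then have "poly q b = 1" by (simp add: q_def)
  moreover have "poly q a = 0" if "a \<in> A - {b}" for a
    using that assms(1) by (auto simp: q_def r_def poly_prod)
  ultimately have "(\<Sum>a\<in>A. poly q a) = 1"
    using b assms(1) by (simp add: sum.remove[of A b])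
  moreover have "degree q \<le> card A - 1"
  proof -
    have "degree r \<le> (\<Sum>c\<in>A-{b}. degree [:-c, 1:])"
      unfolding r_def by (rule degree_prod_sum_le[unfolded o_def]) (use assms(1) in auto)
    also have "\<dots> = card A - 1" using b assms(1) by simp
    finally show ?thesis unfolding q_def using degree_smult_le order_trans by blast
  qed
  ultimately show ?thesis by blast
qed

section \<open>Summation tables\<close>

lemma in_listset_iff: "x \<in> listset As \<longleftrightarrow> list_all2 (\<in>) x As"
  by (induction As arbitrary: x) (auto simp: set_Cons_def list_all2_Cons2)

lemma in_listset_take_Suc:
  assumes "i < length As"
  shows "y \<in> listset (take (Suc i) As) \<longleftrightarrow> (\<exists>x a. y = x @ [a] \<and> x \<in> listset (take i As) \<and> a \<in> As ! i)"
proof (cases y rule: rev_cases)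
  case (snoc x a)
  have "list_all2 (\<in>) (x @ [a]) (take i As @ [As ! i])
    \<longleftrightarrow> list_all2 (\<in>) x (take i As) \<and> a \<in> As ! i"
    using list_all2_lengthD[of "(\<in>)" "x @ [a]" "take i As @ [As ! i]"]
      list_all2_lengthD[of "(\<in>)" x "take i As"]
    by (auto simp: list_all2_append)
  then show ?thesis using snoc by (simp add: in_listset_iff take_Suc_conv_app_nth[OF assms])
qed (simp add: in_listset_iff take_Suc_conv_app_nth[OF assms])

lemma sum_table_full:
  "length x = length As \<Longrightarrow> sum_table As P x = P x"
  by (simp add: sum_table_def restr_def tuples_upto_def tuples_def)

text \<open>Split off the first summation variable. Together with \<open>sum_table_full\<close> this
  recursion determines the table, and later arguments go down from level \<open>length As\<close>
  with it.\<close>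

lemma sum_table_step:
  fixes As :: "'a::{field,finite} set list"
  assumes "length x < length As"
  shows "sum_table As P x = (\<Sum>a\<in>As ! length x. sum_table As P (x @ [a]))"
proof -
  let ?i = "length x"
  have up: "x \<in> tuples_upto (length As)" "x @ [a] \<in> tuples_upto (length As)" for a
    using assms by (auto simp: tuples_upto_def tuples_def)
  have "drop ?i As = As ! ?i # drop (Suc ?i) As" using assms by (simp add: Cons_nth_drop_Suc)
  then have "listset (drop ?i As)
    = (\<lambda>(a, y). a # y) ` (As ! ?i \<times> listset (drop (Suc ?i) As))"
    by (auto simp: set_Cons_def)
  then have "(\<Sum>y\<in>listset (drop ?i As). P (x @ y))
    = (\<Sum>(a, y)\<in>As ! ?i \<times> listset (drop (Suc ?i) As). P (x @ a # y))"
    by (simp add: sum.reindex inj_on_def case_prod_unfold)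
  also have "\<dots> = (\<Sum>a\<in>As ! ?i. \<Sum>y\<in>listset (drop (Suc ?i) As). P (x @ a # y))"
    by (rule sum.cartesian_product[symmetric])
  finally show ?thesis using up by (simp add: sum_table_def restr_def)
qed

text \<open>Downward induction: the top level is \<open>P\<close> itself, and each lower level
  arises by summing out the last coordinate, which preserves the remaining degree bounds.\<close>

lemma sum_table_level_in_RM:
  fixes As :: "'a::{field,finite} set list"
  assumes P: "P \<in> RM (length As) ds" and "i \<le> length As"
  shows "restr (tuples i) (sum_table As P) \<in> RM i ds"
  using assms(2)
proof (induction rule: inc_induct)
  case base
  have "restr (tuples (length As)) (sum_table As P) = P"
    using RM_outside[OF P] by (auto simp: restr_def tuples_def sum_table_full fun_eq_iff)
  then show ?case using P by simp
next
  case (step i)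
  have "restr (tuples i) (sum_table As P)
    = restr (tuples i) (\<lambda>x. \<Sum>a\<in>As ! i. restr (tuples (Suc i)) (sum_table As P) (x @ [a]))"
    using step.hyps by (auto simp: restr_def tuples_def sum_table_step fun_eq_iff)
  then show ?case using RM_sum_last[OF step.IH] by simp
qed

text \<open>Vanishing passes down the levels, because the value at a point of a prefix box is a sum
  of values on the next larger box. This is why the boxes \<open>prefix_box As X i\<close> appear in
  the formula.\<close>

lemma sum_table_level_vanishes:
  fixes As :: "'a::{field,finite} set list"
  assumes P: "\<And>y. y \<in> listset As \<Longrightarrow> P y = 0" and "i \<le> length As"
    and "x \<in> listset (take i As)"
  shows "sum_table As P x = 0"
  using assms(2,3)
proof (induction arbitrary: x rule: inc_induct)
  case base
  then have "length x = length As" by (auto simp: in_listset_iff dest: list_all2_lengthD)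
  then show ?case using base P by (simp add: sum_table_full)
next
  case (step i)
  then have len: "length x = i" by (auto simp: in_listset_iff dest!: list_all2_lengthD)
  have "sum_table As P (x @ [a]) = 0" if "a \<in> As ! i" for a
    using step that by (intro step.IH) (auto simp: in_listset_take_Suc)
  then show ?case using step.hyps len by (simp add: sum_table_step)
qed

text \<open>Translates orthogonality to \<open>zvec As s\<close> into the sum relation at
  \<open>s\<close>. The support of the vector lies inside \<open>S\<close>, so no term is
  lost.\<close>

lemma sum_zvec:
  fixes As :: "'a::{field,finite} set list"
  assumes "finite S" "s \<in> S" "\<And>a. a \<in> As ! length s \<Longrightarrow> s @ [a] \<in> S"
  shows "(\<Sum>x\<in>S. zvec As s x * w x) = w s - (\<Sum>a\<in>As ! length s. w (s @ [a]))"
proof -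
  let ?T = "(\<lambda>a. s @ [a]) ` (As ! length s)"
  have "(\<Sum>x\<in>S. zvec As s x * w x) = (\<Sum>x\<in>insert s ?T. zvec As s x * w x)"
    by (rule sum.mono_neutral_right) (use assms in \<open>auto simp: zvec_def\<close>)
  also have "\<dots> = w s + (\<Sum>x\<in>?T. zvec As s x * w x)"
    by (subst sum.insert) (auto simp: zvec_def)
  also have "(\<Sum>x\<in>?T. zvec As s x * w x) = (\<Sum>x\<in>?T. - w x)"
    by (rule sum.cong) (auto simp: zvec_def)
  also have "\<dots> = - (\<Sum>a\<in>As ! length s. w (s @ [a]))"
    by (simp add: sum.reindex inj_on_def sum_negf)
  finally show ?thesis by simp
qed

section \<open>Extending a word to a summation table\<close>

lemma RM_lift:
  fixes As :: "'a::{field,finite} set list"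
  assumes i: "i < length As" "As ! i \<noteq> {}" "card (As ! i) - 1 \<le> ds ! i"
    and Q: "Q \<in> RM i ds" and R: "R \<in> RM (Suc i) ds"
  shows "\<exists>Q'\<in>RM (Suc i) ds.
    (\<forall>x. length x = i \<longrightarrow> (\<Sum>a\<in>As ! i. Q' (x @ [a])) = Q x) \<and>
    (\<forall>x t. length x = i \<longrightarrow> Q x = (\<Sum>a\<in>As ! i. R (x @ [a])) \<longrightarrow> Q' (x @ [t]) = R (x @ [t]))"
proof -
  obtain q where q: "degree q \<le> card (As ! i) - 1" "(\<Sum>a\<in>As ! i. poly q a) = 1"
    using exists_poly_sum_eq_1[of "As ! i"] i(2) by auto
  \<comment> \<open>\<open>E\<close> measures how far the sums of \<open>R\<close> miss
    \<open>Q\<close>. Adding \<open>E\<close> times \<open>q\<close> repairs every sum, since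
    \<open>q\<close> sums to 1, and leaves \<open>R\<close> unchanged wherever \<open>E\<close> is
    zero.\<close>
  define E where "E = Q - restr (tuples i) (\<lambda>x. \<Sum>a\<in>As ! i. R (x @ [a]))"
  have E: "E \<in> RM i ds"
    unfolding E_def by (intro word.subspace_diff RM_subspace Q RM_sum_last R)
  define Q' where "Q' = R + restr (tuples (Suc i)) (\<lambda>x. E (butlast x) * poly q (last x))"
  have "Q' \<in> RM (Suc i) ds"
    unfolding Q'_def using E q(1) i(3)
    by (intro word.subspace_add RM_subspace R RM_mult_poly_last) auto
  moreover have "Q' (x @ [t]) = R (x @ [t]) + E x * poly q t" if "length x = i" for x t
    using that by (simp add: Q'_def restr_def tuples_def)
  moreover have "E x = Q x - (\<Sum>a\<in>As ! i. R (x @ [a]))" if "length x = i" for x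
    using that by (simp add: E_def restr_def tuples_def)
  ultimately show ?thesis
    by (intro bexI[of _ Q']) (auto simp: sum.distrib sum_distrib_left[symmetric] q(2))
qed

text \<open>Assumption \<open>rel\<close> encodes orthogonality to the z-vectors, and
  \<open>lev\<close> encodes orthogonality to the level duals. Since \<open>lev\<close> says nothing
  about level 0, the value at \<open>[]\<close> is treated separately, using that \<open>S\<close>
  is not just \<open>{[]}\<close>.\<close>

lemma extends_to_sum_table:
  fixes As :: "'a::{field,finite} set list"
  assumes ne: "\<forall>i<m. As ! i \<noteq> {}" and deg: "\<forall>i<m. card (As ! i) - 1 \<le> ds ! i"
    and len: "length As = m" and S: "S \<subseteq> tuples_upto m" "closed_under As S"
    and X: "X \<in> {{}, listset As}" "X = {} \<or> S \<noteq> {[]}"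
    and w: "w \<in> words S"
    and rel: "\<And>s. s \<in> extendable S \<Longrightarrow> w s = (\<Sum>a\<in>As ! length s. w (s @ [a]))"
    and lev: "\<And>i. i \<in> {1..m} \<Longrightarrow> \<exists>R\<in>zero_code (prefix_box As X i) (RM i ds). \<forall>x\<in>level S i. R x = w x"
  shows "w \<in> restr_code S (zero_code X (SigmaRM As ds))"
proof -
  \<comment> \<open>The guards \<open>i \<le> m\<close> and \<open>i < m\<close> make the conditions
    vacuous beyond level \<open>m\<close>, so that an infinite sequence can be chosen.\<close>
  let ?P = "\<lambda>i Q. i \<le> m \<longrightarrow> Q \<in> zero_code (prefix_box As X i) (RM i ds) \<and> (\<forall>x\<in>level S i. Q x = w x)"
  let ?R = "\<lambda>i Q Q'. i < m \<longrightarrow> (\<forall>x. length x = i \<longrightarrow> (\<Sum>a\<in>As ! i. Q' (x @ [a])) = Q x)"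
  have closed: "s \<in> S" "s \<in> extendable S" "\<And>a. a \<in> As ! length s \<Longrightarrow> s @ [a] \<in> S"
    if "s @ [t] \<in> S" for s t
    using that S(2) by (auto simp: closed_under_def extendable_def)
  \<comment> \<open>For nonempty \<open>X\<close> the box at level 0 is \<open>{[]}\<close>, so the
    initial codeword must vanish there. If \<open>[]\<close> lies in \<open>S\<close>, then
    \<open>S\<close> also has a nonempty tuple, hence by closure some \<open>[t]\<close> and all
    \<open>[a]\<close> with \<open>a\<close> in the first set. On these \<open>w\<close> is zero,
    and the relation at \<open>[]\<close> gives the claim.\<close>
  have Nil: "w [] = 0" if "X \<noteq> {}"
  proof (cases "[] \<in> S")
    case True
    then have "\<not> S \<subseteq> {[]}" using X(2) that by (auto simp: subset_singleton_iff)
    then obtain x where x: "x \<in> S" "x \<noteq> []" unfolding subset_iff by auto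
    have "\<exists>t. [t] \<in> S" using x
    proof (induction x rule: rev_induct)
      case (snoc t x)
      then show ?case using closed(1)[of x t] by (cases x) auto
    qed simp
    then obtain t where t: "[t] \<in> S" ..
    have "length [t] \<le> m" using t S(1) by (auto simp: tuples_upto_def tuples_def)
    then have m: "0 < m" by simp
    then obtain R where R: "R \<in> zero_code (prefix_box As X 1) (RM 1 ds)" "\<forall>x\<in>level S 1. R x = w x"
      using lev[of 1] by auto
    have "w [a] = 0" if "a \<in> As ! 0" for a
    proof -
      have "[a] \<in> level S 1" using closed(3)[of "[]" t a] t that by (simp add: level_def)
      moreover have "[a] \<in> prefix_box As X 1"
        using in_listset_take_Suc[of 0 As "[a]"] m len that \<open>X \<noteq> {}\<close> by (simp add: prefix_box_def)
      ultimately show ?thesis using R by (auto simp: zero_code_def)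
    qed
    then show ?thesis using rel[of "[]"] closed(2)[of "[]" t] t by simp
  qed (use w in \<open>auto simp: words_def\<close>)
  have "\<exists>Q. \<forall>i. ?P i (Q i) \<and> ?R i (Q i) (Q (Suc i))"
  proof (rule dependent_nat_choice)
    show "\<exists>Q. ?P 0 Q"
      \<comment> \<open>The construction starts from the constant \<open>w []\<close>, which is 0 by
        convention when \<open>[]\<close> is not in \<open>S\<close>.\<close>
      by (rule exI[of _ "restr (tuples 0) (\<lambda>_. w [])"])
        (use Nil RM_const[of "w []" ds] in
          \<open>auto simp: zero_code_def prefix_box_def level_def restr_def tuples_def\<close>)
  next
    fix Q i
    assume Q: "?P i Q"
    show "\<exists>Q'. ?P (Suc i) Q' \<and> ?R i Q Q'"
    proof (cases "i < m")
      case True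
      then have QRM: "Q \<in> RM i ds" and Q0: "\<And>x. x \<in> prefix_box As X i \<Longrightarrow> Q x = 0"
        and Qw: "\<And>x. x \<in> level S i \<Longrightarrow> Q x = w x"
        using Q by (auto simp: zero_code_def)
      obtain R where R: "R \<in> RM (Suc i) ds" "\<And>x. x \<in> prefix_box As X (Suc i) \<Longrightarrow> R x = 0"
        "\<And>x. x \<in> level S (Suc i) \<Longrightarrow> R x = w x"
        using lev[of "Suc i"] True by (auto simp: zero_code_def)
      obtain Q' where Q': "Q' \<in> RM (Suc i) ds"
        "\<And>x. length x = i \<Longrightarrow> (\<Sum>a\<in>As ! i. Q' (x @ [a])) = Q x"
        "\<And>x t. length x = i \<Longrightarrow> Q x = (\<Sum>a\<in>As ! i. R (x @ [a])) \<Longrightarrow> Q' (x @ [t]) = R (x @ [t])"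
        using RM_lift[of i As ds Q R] True ne deg len QRM R(1) by auto
      \<comment> \<open>On the box, \<open>Q x\<close> and all the values \<open>R (x @ [a])\<close>
        are zero, so the sum relation at \<open>x\<close> reads 0 = 0 and \<open>Q'\<close> inherits
        the zero of \<open>R\<close>.\<close>
      have "Q' y = 0" if y: "y \<in> prefix_box As X (Suc i)" for y
      proof -
        have X: "X \<noteq> {}" using y by (auto simp: prefix_box_def)
        obtain x t where x: "y = x @ [t]" "x \<in> listset (take i As)"
          using y X True len by (auto simp: prefix_box_def in_listset_take_Suc)
        have lx: "length x = i"
          using x(2) True len by (auto simp: in_listset_iff dest!: list_all2_lengthD)
        have "R (x @ [a]) = 0" if "a \<in> As ! i" for a
          using that x X True len by (intro R(2)) (auto simp: prefix_box_def in_listset_take_Suc)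
        moreover have "Q x = 0" using x X by (intro Q0) (simp add: prefix_box_def)
        ultimately show ?thesis using Q'(3)[of x t] lx x(1) R(2)[OF y] by simp
      qed
      \<comment> \<open>Closure puts all \<open>x @ [a]\<close> with \<open>a\<close> in
        \<open>As ! i\<close> into \<open>S\<close>, where \<open>R\<close> agrees with
        \<open>w\<close>. The relation of \<open>w\<close> at \<open>x\<close> is then the condition
        under which the lift keeps \<open>R\<close>.\<close>
      moreover have "Q' y = w y" if y: "y \<in> level S (Suc i)" for y
      proof -
        obtain x t where x: "y = x @ [t]" "length x = i"
          using y by (cases y rule: rev_cases) (auto simp: level_def)
        have xS: "x @ [t] \<in> S" using x y by (simp add: level_def)
        have "R (x @ [a]) = w (x @ [a])" if "a \<in> As ! i" for a
          using closed(3)[OF xS] that x(2) by (intro R(3)) (simp add: level_def)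
        then have "(\<Sum>a\<in>As ! i. R (x @ [a])) = w x"
          using rel[OF closed(2)[OF xS]] x(2) by simp
        moreover have "Q x = w x" using closed(1)[OF xS] x(2) by (intro Qw) (simp add: level_def)
        ultimately show ?thesis using Q'(3)[of x t] x R(3)[OF y] by simp
      qed
      ultimately show ?thesis using Q'(1,2) by (intro exI[of _ Q']) (auto simp: zero_code_def)
    qed auto
  qed
  then obtain Q where Q: "\<And>i. ?P i (Q i)" "\<And>i. ?R i (Q i) (Q (Suc i))" by blast
  \<comment> \<open>Both sides satisfy the same downward recursion and agree at level
    \<open>m\<close>.\<close>
  have table: "sum_table As (Q m) x = Q (length x) x" if "length x \<le> m" for x
  proof -
    have "length x = i \<Longrightarrow> sum_table As (Q m) x = Q i x" if "i \<le> m" for i x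
      using that
    proof (induction arbitrary: x rule: inc_induct)
      case base
      then show ?case using len by (simp add: sum_table_full)
    next
      case (step i)
      then show ?case using Q(2)[of i] len by (simp add: sum_table_step)
    qed
    then show ?thesis using that by simp
  qed
  have "sum_table As (Q m) \<in> zero_code X (SigmaRM As ds)"
  proof -
    have "sum_table As (Q m) y = 0" if "y \<in> X" for y
    proof -
      have "X = listset As" using X(1) that by auto
      then have "length y = m" "y \<in> prefix_box As X m"
        using that len by (auto simp: in_listset_iff prefix_box_def dest: list_all2_lengthD)
      then show ?thesis using Q(1)[of m] table[of y] by (simp add: zero_code_def)
    qed
    then show ?thesis using Q(1)[of m] len by (auto simp: zero_code_def SigmaRM_def)
  qed
  moreover have "w = restr S (sum_table As (Q m))"
  proof
    fix x
    have "sum_table As (Q m) x = w x" if "x \<in> S"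
      using that S(1) table[of x] Q(1)[of "length x"]
      by (auto simp: tuples_upto_def tuples_def level_def)
    then show "w x = restr S (sum_table As (Q m)) x" using w by (auto simp: restr_def words_def)
  qed
  ultimately show ?thesis by (auto simp: restr_code_def)
qed

section \<open>The dual code formula\<close>

lemma restr_zero_code_subspace:
  fixes C :: "('i \<Rightarrow> 'a::field) set"
  assumes "word.subspace C"
  shows "word.subspace (restr_code D (zero_code Y C))"
proof (rule word.subspaceI)
  show "0 \<in> restr_code D (zero_code Y C)"
    unfolding restr_code_def zero_code_def
    by (rule image_eqI[of _ _ 0]) (use word.subspace_0[OF assms] in \<open>auto simp: restr_def\<close>)
next
  fix f g
  assume "f \<in> restr_code D (zero_code Y C)" "g \<in> restr_code D (zero_code Y C)"
  then obtain f' g' where "f = restr D f'" "g = restr D g'" "f' \<in> zero_code Y C" "g' \<in> zero_code Y C"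
    by (auto simp: restr_code_def)
  then show "f + g \<in> restr_code D (zero_code Y C)"
    unfolding restr_code_def zero_code_def
    by (intro image_eqI[of _ _ "f' + g'"])
      (use word.subspace_add[OF assms] in \<open>auto simp: restr_def\<close>)
next
  fix c f
  assume "f \<in> restr_code D (zero_code Y C)"
  then obtain f' where "f = restr D f'" "f' \<in> zero_code Y C"
    by (auto simp: restr_code_def)
  then show "scale_word c f \<in> restr_code D (zero_code Y C)"
    unfolding restr_code_def zero_code_def
    by (intro image_eqI[of _ _ "scale_word c f'"])
      (use word.subspace_scale[OF assms] in \<open>auto simp: restr_def scale_word_def\<close>)
qed

theorem theorem6p5:
  fixes As :: "'a::{field,finite} set list"
    and ds :: "nat list"
    and S X :: "'a list set"
    and m :: nat
  assumes "length As = m" and "length ds = m"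
    and "\<forall>i<m. As ! i \<noteq> {}"
    and "\<forall>i<m. card (As ! i) - 1 \<le> ds ! i"
    and "S \<subseteq> tuples_upto m"
    and "closed_under As S"
    and "X \<in> {{}, listset As}"
    and nondegenerate: "X = {} \<or> S \<noteq> {[]}"
  shows "dual S (restr_code S (zero_code X (SigmaRM As ds))) =
    word.span (zvec As ` extendable S \<union>
      (\<Union>i\<in>{1..m}. dual (level S i)
         (restr_code (level S i) (zero_code (prefix_box As X i) (RM i (take i ds))))))"
    (is "?L = word.span (?Z \<union> ?B)")
proof
  have fin: "finite S"
  proof (rule finite_subset[OF assms(5)])
    show "finite (tuples_upto m :: 'a list set)"
      using finite_lists_length_eq[of "UNIV :: 'a set"] by (auto simp: tuples_upto_def tuples_def)
  qed
  have finl: "finite (level S i)" "level S i \<subseteq> S" for i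
    using fin by (auto simp: level_def)
  have ext: "s \<in> S" "\<And>a. a \<in> As ! length s \<Longrightarrow> s @ [a] \<in> S" "length s < m"
    if "s \<in> extendable S" for s
    using that assms(5,6) by (auto simp: extendable_def closed_under_def tuples_upto_def tuples_def)
  let ?C = "\<lambda>i. restr_code (level S i) (zero_code (prefix_box As X i) (RM i (take i ds)))"
  \<comment> \<open>Zero padding does not change dot products, so orthogonality on a level and on
    all of \<open>S\<close> can be exchanged.\<close>
  have sum_level: "(\<Sum>x\<in>level S i. u x * f x) = (\<Sum>x\<in>S. u x * f x)"
    if "u \<in> words (level S i)" for u f :: "'a list \<Rightarrow> 'a" and i
    by (rule sum.mono_neutral_left) (use that fin finl in \<open>auto simp: words_def\<close>)
  have words: "?Z \<union> ?B \<subseteq> words S"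
  proof -
    have "zvec As s \<in> words S" if "s \<in> extendable S" for s
      using ext[OF that] by (auto simp: words_def zvec_def)
    moreover have "dual (level S i) C \<subseteq> words S" for i and C :: "('a list \<Rightarrow> 'a) set"
      using finl by (auto simp: dual_def words_def)
    ultimately show ?thesis by blast
  qed
  show "word.span (?Z \<union> ?B) \<subseteq> ?L"
  proof (rule word.span_minimal[OF _ dual_subspace])
    show "?Z \<union> ?B \<subseteq> ?L"
    proof
      fix u
      assume u: "u \<in> ?Z \<union> ?B"
      have "(\<Sum>x\<in>S. u x * restr S w x) = 0" if w: "w \<in> zero_code X (SigmaRM As ds)" for w
      proof -
        obtain P where P: "P \<in> RM m ds" "w = sum_table As P" "\<And>y. y \<in> X \<Longrightarrow> w y = 0"
          using w assms(1) by (auto simp: zero_code_def SigmaRM_def)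
        have restr_sum: "(\<Sum>x\<in>S. u x * restr S w x) = (\<Sum>x\<in>S. u x * w x)"
          by (rule sum.cong) (auto simp: restr_def)
        from u consider (z) s where "s \<in> extendable S" "u = zvec As s"
          | (b) i where "i \<in> {1..m}" "u \<in> dual (level S i) (?C i)" by blast
        then show ?thesis
        proof cases
          case z
          then show ?thesis
            unfolding restr_sum using sum_zvec[of S s As w, OF fin ext(1,2)[OF z(1)]]
            by (simp add: P(2) sum_table_step ext(3) assms(1))
        next
          case b
          \<comment> \<open>Level \<open>i\<close> of the table is a Reed-Muller codeword that
            vanishes on the prefix box, so \<open>u\<close> is orthogonal to its
            restriction.\<close>
          let ?f = "restr (tuples i) w"
          have "?f \<in> RM i (take i ds)"
            using sum_table_level_in_RM[of P As ds i] P b(1) assms(1) by (simp add: RM_take)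
          moreover have "?f y = 0" if y: "y \<in> prefix_box As X i" for y
          proof -
            have X: "X = listset As" using y assms(7) by (auto simp: prefix_box_def)
            have "P y = 0" if "y \<in> listset As" for y
              using P(3)[of y] that X list_all2_lengthD[of "(\<in>)" y As]
              by (simp add: P(2) in_listset_iff sum_table_full)
            then have "w y = 0"
              using y b(1) assms(1) unfolding P(2)
              by (intro sum_table_level_vanishes[of As P i]) (auto simp: prefix_box_def split: if_splits)
            then show ?thesis by (simp add: restr_def)
          qed
          ultimately have "restr (level S i) ?f \<in> ?C i"
            by (auto simp: restr_code_def zero_code_def)
          then have "(\<Sum>x\<in>level S i. u x * restr (level S i) ?f x) = 0"
            using b(2) by (auto simp: dual_def)
          moreover have "(\<Sum>x\<in>level S i. u x * restr (level S i) ?f x) = (\<Sum>x\<in>level S i. u x * w x)"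
            by (rule sum.cong) (auto simp: restr_def level_def tuples_def)
          ultimately show ?thesis using sum_level[of u i w] b(2) by (simp add: restr_sum dual_def)
        qed
      qed
      then show "u \<in> ?L" using words u by (auto simp: dual_def restr_code_def)
    qed
  qed
  show "?L \<subseteq> word.span (?Z \<union> ?B)"
  proof
    fix u
    assume u: "u \<in> ?L"
    show "u \<in> word.span (?Z \<union> ?B)"
    \<comment> \<open>It remains to test \<open>u\<close> against each \<open>w\<close> orthogonal
      to the span. Such a \<open>w\<close> will turn out to be in the restricted code, to which
      \<open>u\<close> is orthogonal by assumption.\<close>
    proof (rule double_dual_subset[OF fin word.subspace_span])
      show "word.span (?Z \<union> ?B) \<subseteq> words S" by (rule word.span_minimal[OF words words_subspace])
      show "u \<in> words S" using u by (simp add: dual_def)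
      fix w
      assume w: "w \<in> dual S (word.span (?Z \<union> ?B))"
      then have wS: "w \<in> words S"
        and orth: "\<And>v. v \<in> ?Z \<union> ?B \<Longrightarrow> (\<Sum>x\<in>S. v x * w x) = 0"
        by (auto simp: dual_def mult.commute intro: word.span_base)
      have "w \<in> restr_code S (zero_code X (SigmaRM As ds))"
      proof (rule extends_to_sum_table[OF assms(3,4,1,5,6,7) nondegenerate wS])
        fix s
        assume s: "s \<in> extendable S"
        then show "w s = (\<Sum>a\<in>As ! length s. w (s @ [a]))"
          using sum_zvec[of S s As w, OF fin ext(1,2)[OF s]] orth[of "zvec As s"] by simp
      next
        fix i
        assume i: "i \<in> {1..m}"
        \<comment> \<open>Double duality on a single level: \<open>w\<close> is orthogonal to every
          padded dual vector of \<open>?C i\<close>, so its part on that level is a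
          codeword.\<close>
        have "restr (level S i) w \<in> ?C i"
        proof (rule double_dual_subset[OF finl(1)])
          show "word.subspace (?C i)" by (rule restr_zero_code_subspace[OF RM_subspace])
          show "?C i \<subseteq> words (level S i)" by (auto simp: restr_code_def words_def restr_def)
          show "restr (level S i) w \<in> words (level S i)" by (simp add: words_def restr_def)
          fix v
          assume v: "v \<in> dual (level S i) (?C i)"
          have "(\<Sum>x\<in>level S i. v x * restr (level S i) w x) = (\<Sum>x\<in>level S i. v x * w x)"
            by (rule sum.cong) (auto simp: restr_def)
          also have "\<dots> = (\<Sum>x\<in>S. v x * w x)" using v by (intro sum_level) (simp add: dual_def)
          also have "\<dots> = 0" using v i by (intro orth) blast
          finally show "(\<Sum>x\<in>level S i. v x * restr (level S i) w x) = 0" .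
        qed
        then obtain R where "R \<in> zero_code (prefix_box As X i) (RM i (take i ds))"
          "restr (level S i) w = restr (level S i) R" by (auto simp: restr_code_def)
        then show "\<exists>R\<in>zero_code (prefix_box As X i) (RM i ds). \<forall>x\<in>level S i. R x = w x"
          by (intro bexI[of _ R]) (auto simp: RM_take restr_def fun_eq_iff split: if_splits)
      qed
      then show "(\<Sum>x\<in>S. w x * u x) = 0" using u by (auto simp: dual_def mult.commute)
    qed
  qed
qed

end
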